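(* Suppose that a graph-partitioned matrix $(A,\mathbb{G})$ possesses a Dewilde-van der Veen (DV) representation with dimensions $r_i$ for $i$ in the vertex set of $\mathbb{G}$. Then $(A,\mathbb{G})$ is GIRS-$2r$, where $r=\max_i r_i$, the maximum being over all vertices $i$ of $\mathbb{G}$.
   Context: A graph-partitioned matrix $(A,\mathbb{G})$ consists of a finite undirected graph $\mathbb{G}$ (without loops) with vertex set $\{1,\ldots,n\}$, block sizes $N_1,\ldots,N_n$, and $A\in\mathbb{R}^{N\times N}$, $N=\sum_iN_i$, partitioned into blocks $A_{ij}\in\mathbb{R}^{N_i\times N_j}$. DV representation: let $\mathbb{N}(i)$ denote the set of vertices adjacent to $i$ in $\mathbb{G}$. A DV representation of $A$ with dimensions $r_i\ge0$ is a collection of real matrices $V_i\in\mathbb{R}^{N_i\times r_i}$ and $D_i\in\mathbb{R}^{N_i\times N_i}$ for each vertex $i$, and $W_{i,j}\in\mathbb{R}^{r_i\times r_j}$, $U_{i,j}\in\mathbb{R}^{N_i\times r_j}$ for each vertex $i$ and $j\in\mathbb{N}(i)$, such that the implicit equations $$g_i=V_i^Tx_i+\sum_{j\in\mathbb{N}(i)}W_{i,j}g_j,\qquad b_i=D_ix_i+\sum_{j\in\mathbb{N}(i)}U_{i,j}g_j\qquad(i=1,\dots,n)$$ are uniquely solvable for $(g_i)_i$, $(b_i)_i$ for every $(x_i)_i$ with $x_i\in\mathbb{R}^{N_i}$ (where $g_i\in\mathbb{R}^{r_i}$), and the resulting $b_i$ satisfy $b_i=\sum_{j=1}^nA_{ij}x_j$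 for all $i$. GIRS: for an induced subgraph $\mathbb{H}$ of $\mathbb{G}$, $\overline{\mathbb{H}}$ is the induced subgraph on the complementary vertex set, $A_{\overline{\mathbb{H}},\mathbb{H}}$ is the submatrix formed by the blocks $A_{ij}$ with $i$ in $\overline{\mathbb{H}}$ and $j$ in $\mathbb{H}$, and $\rho(\mathbb{H})$ is the number of edges of $\mathbb{G}$ between $\mathbb{H}$ and $\overline{\mathbb{H}}$. For a constant $c\ge0$, $(A,\mathbb{G})$ is GIRS-$c$ if $\operatorname{rank}(A_{\overline{\mathbb{H}},\mathbb{H}})\le c\,\rho(\mathbb{H})$ for all induced subgraphs $\mathbb{H}$. *)

theory Defs
  imports
    "HOL-Library.FuncSet"
    "Jordan_Normal_Form.DL_Rank"
    "Jordan_Normal_Form.DL_Submatrix"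
begin

(* A finite simple graph on the vertices {1..n} is given by its set E of edges, each edge being
   a two-element set of vertices. *)
definition simple_graph :: "nat \<Rightarrow> nat set set \<Rightarrow> bool" where
  "simple_graph n E \<longleftrightarrow> (\<forall>e\<in>E. e \<subseteq> {1..n} \<and> card e = 2)"

definition neighbours :: "nat set set \<Rightarrow> nat \<Rightarrow> nat set" where
  "neighbours E i = {j. {i, j} \<in> E}"

(* Vertices count from 1, but rows and columns of matrices count from 0: the block of vertex i
   consists of the N i consecutive indices following those of the vertices 1, ..., i - 1. *)
definition block_indices :: "(nat \<Rightarrow> nat) \<Rightarrow> nat \<Rightarrow> nat set" where
  "block_indices N i = {(\<Sum>k\<in>{1..<i}. N k) ..< (\<Sum>k\<in>{1..i}. N k)}"

(* The submatrix formed by the blocks A_ij with i in S and j in T, in their original order. *)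
definition block_submatrix ::
  "(nat \<Rightarrow> nat) \<Rightarrow> real mat \<Rightarrow> nat set \<Rightarrow> nat set \<Rightarrow> real mat" where
  "block_submatrix N A S T =
     submatrix A (\<Union>i\<in>S. block_indices N i) (\<Union>j\<in>T. block_indices N j)"

definition block :: "(nat \<Rightarrow> nat) \<Rightarrow> real mat \<Rightarrow> nat \<Rightarrow> nat \<Rightarrow> real mat" where
  "block N A i j = block_submatrix N A {i} {j}"

definition graph_partitioned_matrix ::
  "nat \<Rightarrow> nat set set \<Rightarrow> (nat \<Rightarrow> nat) \<Rightarrow> real mat \<Rightarrow> bool" where
  "graph_partitioned_matrix n E N A \<longleftrightarrow>
     simple_graph n E \<and> A \<in> carrier_mat (\<Sum>i\<in>{1..n}. N i) (\<Sum>i\<in>{1..n}. N i)"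

(* Families indexed by vertices are taken extensional (PiE), so that uniqueness of a solution
   below concerns only its values at the vertices 1, ..., n. *)
definition dv_solution ::
  "nat \<Rightarrow> nat set set \<Rightarrow> (nat \<Rightarrow> nat) \<Rightarrow> (nat \<Rightarrow> nat) \<Rightarrow>
   (nat \<Rightarrow> real mat) \<Rightarrow> (nat \<Rightarrow> real mat) \<Rightarrow>
   (nat \<Rightarrow> nat \<Rightarrow> real mat) \<Rightarrow> (nat \<Rightarrow> nat \<Rightarrow> real mat) \<Rightarrow>
   (nat \<Rightarrow> real vec) \<Rightarrow> (nat \<Rightarrow> real vec) \<Rightarrow> (nat \<Rightarrow> real vec) \<Rightarrow> bool" where
  "dv_solution n E N r V D W U x g b \<longleftrightarrow>
     g \<in> (\<Pi>\<^sub>E i\<in>{1..n}. carrier_vec (r i)) \<and>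
     b \<in> (\<Pi>\<^sub>E i\<in>{1..n}. carrier_vec (N i)) \<and>
     (\<forall>i\<in>{1..n}.
        g i = transpose_mat (V i) *\<^sub>v x i +
              finsum_vec TYPE(real) (r i) (\<lambda>j. W i j *\<^sub>v g j) (neighbours E i) \<and>
        b i = D i *\<^sub>v x i +
              finsum_vec TYPE(real) (N i) (\<lambda>j. U i j *\<^sub>v g j) (neighbours E i))"

definition dv_representation ::
  "nat \<Rightarrow> nat set set \<Rightarrow> (nat \<Rightarrow> nat) \<Rightarrow> real mat \<Rightarrow> (nat \<Rightarrow> nat) \<Rightarrow>
   (nat \<Rightarrow> real mat) \<Rightarrow> (nat \<Rightarrow> real mat) \<Rightarrow>
   (nat \<Rightarrow> nat \<Rightarrow> real mat) \<Rightarrow> (nat \<Rightarrow> nat \<Rightarrow> real mat) \<Rightarrow> bool" where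
  "dv_representation n E N A r V D W U \<longleftrightarrow>
     (\<forall>i\<in>{1..n}. V i \<in> carrier_mat (N i) (r i) \<and> D i \<in> carrier_mat (N i) (N i)) \<and>
     (\<forall>i\<in>{1..n}. \<forall>j\<in>neighbours E i.
        W i j \<in> carrier_mat (r i) (r j) \<and> U i j \<in> carrier_mat (N i) (r j)) \<and>
     (\<forall>x \<in> (\<Pi> i\<in>{1..n}. carrier_vec (N i)).
        (\<exists>!(g, b). dv_solution n E N r V D W U x g b) \<and>
        (\<forall>g b. dv_solution n E N r V D W U x g b \<longrightarrow>
           (\<forall>i\<in>{1..n}.
              b i = finsum_vec TYPE(real) (N i) (\<lambda>j. block N A i j *\<^sub>v x j) {1..n})))"

definition mat_rank :: "real mat \<Rightarrow> nat" where
  "mat_rank B = vec_space.rank (dim_row B) B"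

(* The number of edges between the vertices in H and the remaining ones. *)
definition cut_size :: "nat \<Rightarrow> nat set set \<Rightarrow> nat set \<Rightarrow> nat" where
  "cut_size n E H = card {e \<in> E. \<exists>i\<in>H. \<exists>j\<in>{1..n} - H. e = {i, j}}"

(* Induced subgraphs are represented by their vertex sets H. *)
definition girs :: "nat \<Rightarrow> nat set set \<Rightarrow> (nat \<Rightarrow> nat) \<Rightarrow> real mat \<Rightarrow> real \<Rightarrow> bool" where
  "girs n E N A c \<longleftrightarrow>
     (\<forall>H \<subseteq> {1..n}.
        real (mat_rank (block_submatrix N A ({1..n} - H) H)) \<le> c * real (cut_size n E H))"

end

(* Feed the DV equations an input x supported on H. If the resulting g vanishes at both endpoints
   of every edge leaving H, then the family equal to g on H and to 0 off H solves the g-equations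
   as well, so by uniqueness the output b vanishes off H. Hence the submatrix of A to be bounded
   annihilates every x whose g vanishes at these endpoints. This imposes at most r conditions on x
   for each of the at most 2 rho(H) endpoints, which bounds the rank by 2 r rho(H). *)
theory Submission
  imports Defs
begin

section \<open>Bounding a rank by counting linear conditions\<close>

text \<open>Padding the coefficient matrix with zero rows to a square one makes its determinant
  vanish. The index sets are arbitrary because later the unknowns are indexed by column vectors and
  the equations by pairs of a vertex and a coordinate.\<close>

lemma wide_system_nontrivial_solution:
  fixes f :: "'k \<Rightarrow> 's \<Rightarrow> 'a :: field"
  assumes "finite K" "finite S" "card K < card S"
  obtains a where "\<exists>s\<in>S. a s \<noteq> 0" "\<And>k. k \<in> K \<Longrightarrow> (\<Sum>s\<in>S. f k s * a s) = 0"
proof -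
  define m where "m = card S"
  obtain hS where hS: "bij_betw hS {0..<m} S"
    using ex_bij_betw_nat_finite[OF \<open>finite S\<close>] unfolding m_def by blast
  obtain hK where hK: "bij_betw hK {0..<card K} K"
    using ex_bij_betw_nat_finite[OF \<open>finite K\<close>] by blast
  define B where "B = mat m m (\<lambda>(i, j). if i < card K then f (hK i) (hS j) else 0)"
  have B: "B \<in> carrier_mat m m"
    by (simp add: B_def)
  have last: "card K < m"
    using assms(3) by (simp add: m_def)
  have rows: "row B \<in> {0..<m} \<rightarrow> carrier_vec m"
    using B by auto
  \<comment> \<open>\<open>det_row_0\<close> expects a matrix with one row replaced by zero. Row
    \<open>card K\<close> of \<open>B\<close> is already zero, and it exists because
    \<open>card K < m\<close>.\<close>
  have "B = mat\<^sub>r m m (\<lambda>i. if i = card K then 0\<^sub>v m else row B i)"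
    by (rule eq_matI) (auto simp: B_def)
  then have "det B = 0"
    using det_row_0[OF last rows] by (rule ssubst)
  then obtain v where v: "v \<in> carrier_vec m" "v \<noteq> 0\<^sub>v m" "B *\<^sub>v v = 0\<^sub>v m"
    using det_0_iff_vec_prod_zero_field[OF B] by blast
  obtain t where t: "t < m" "v $ t \<noteq> 0"
    using v(1,2) by (metis carrier_vecD eq_vecI index_zero_vec)
  \<comment> \<open>The kernel vector is carried from positions back to elements of \<open>S\<close>
    through the inverse of the enumeration \<open>hS\<close>.\<close>
  define a where "a = (\<lambda>s. v $ the_inv_into {0..<m} hS s)"
  have a: "a (hS j) = v $ j" if "j < m" for j
    using the_inv_into_f_f[of hS "{0..<m}" j] hS that by (simp add: a_def bij_betw_def)
  show thesis
  proof
    show "\<exists>s\<in>S. a s \<noteq> 0"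
      using t a[of t] bij_betw_apply[OF hS, of t] by (intro bexI[of _ "hS t"]) auto
    fix k assume "k \<in> K"
    then obtain i where i: "i < card K" "k = hK i"
      using bij_betw_imp_surj_on[OF hK] by (metis atLeastLessThan_iff imageE)
    have "(\<Sum>s\<in>S. f k s * a s) = (\<Sum>j = 0..<m. f k (hS j) * v $ j)"
      using a by (subst sum.reindex_bij_betw[OF hS, symmetric]) auto
    also have "\<dots> = (B *\<^sub>v v) $ i"
      using i last v(1) by (auto simp: B_def scalar_prod_def)
    finally show "(\<Sum>s\<in>S. f k s * a s) = 0"
      using v(3) i last by simp
  qed
qed

text \<open>If independent columns outnumbered the functionals, some nonzero coefficient vector
  supported on these columns would be annihilated by all functionals, hence by \<open>M\<close>,
  contradicting independence.\<close>

lemma rank_le_number_of_functionals: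
  fixes M :: "real mat"
  assumes M: "M \<in> carrier_mat p q" and K: "finite K"
    and ker: "\<And>v. v \<in> carrier_vec q \<Longrightarrow> (\<And>k. k \<in> K \<Longrightarrow> (\<Sum>c<q. f k c * v $ c) = 0)
                \<Longrightarrow> M *\<^sub>v v = 0\<^sub>v p"
  shows "vec_space.rank p M \<le> card K"
proof -
  interpret vec_space "TYPE(real)" p .
  \<comment> \<open>By \<open>rank_card_indpt\<close>, a maximal independent set of columns has as
    many elements as the rank.\<close>
  obtain S where maxS: "maximal S (\<lambda>T. T \<subseteq> set (cols M) \<and> lin_indpt T)"
    using maximal_exists[of "\<lambda>T. T \<subseteq> set (cols M) \<and> lin_indpt T" "card (set (cols M))" "{}"]
    by (meson List.finite_set card_mono empty_iff empty_subsetI finite_lin_indpt2 rev_finite_subset)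
  then have S: "S \<subseteq> set (cols M)" "lin_indpt S"
    by (auto simp: maximal_def)
  have finS: "finite S"
    using S(1) finite_subset by blast
  have Sp: "S \<subseteq> carrier_vec p"
    using S(1) cols_dim M by blast
  have "\<exists>c<q. col M c = s" if "s \<in> S" for s
    using S(1) that M by (metis carrier_matD(2) cols_length cols_nth in_set_conv_nth subsetD)
  \<comment> \<open>\<open>S\<close> consists of vectors and \<open>M\<close> may repeat a column,
    so one position is chosen for each vector.\<close>
  then obtain idx where idx: "\<And>s. s \<in> S \<Longrightarrow> idx s < q \<and> col M (idx s) = s"
    by metis
  then have inj: "inj_on idx S"
    by (metis inj_onI)
  have "card S \<le> card K"
  proof (rule ccontr)
    assume "\<not> card S \<le> card K"
    then obtain a where a: "\<exists>s\<in>S. a s \<noteq> 0"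
      "\<And>k. k \<in> K \<Longrightarrow> (\<Sum>s\<in>S. f k (idx s) * a s) = 0"
      using wide_system_nontrivial_solution[OF K finS, of "\<lambda>k s. f k (idx s)"] by (metis not_le)
    define v where "v = vec q (\<lambda>c. if c \<in> idx ` S then a (col M c) else 0)"
    have v: "v \<in> carrier_vec q"
      by (simp add: v_def)
    \<comment> \<open>\<open>h\<close> is kept general: it is a functional \<open>f k\<close> in one
      use and a row of \<open>M\<close> in the other.\<close>
    have expand: "(\<Sum>c<q. h c * v $ c) = (\<Sum>s\<in>S. h (idx s) * a s)" for h :: "nat \<Rightarrow> real"
    proof -
      have "(\<Sum>c<q. h c * v $ c) = (\<Sum>c\<in>idx ` S. h c * v $ c)"
        using idx by (intro sum.mono_neutral_right) (auto simp: v_def)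
      also have "\<dots> = (\<Sum>s\<in>S. h (idx s) * a s)"
        using idx by (subst sum.reindex[OF inj]) (auto simp: v_def intro!: sum.cong)
      finally show ?thesis .
    qed
    have Mv: "M *\<^sub>v v = 0\<^sub>v p"
      using ker[OF v] a(2) expand by simp
    have "lincomb a S = 0\<^sub>v p"
    proof (rule eq_vecI)
      show "dim_vec (lincomb a S) = dim_vec (0\<^sub>v p)"
        using lincomb_dim[OF finS Sp] by simp
      fix i assume "i < dim_vec (0\<^sub>v p)"
      then have i: "i < p" by simp
      have "lincomb a S $ i = (\<Sum>s\<in>S. a s * s $ i)"
        using lincomb_index[OF i Sp] .
      also have "\<dots> = (\<Sum>s\<in>S. M $$ (i, idx s) * a s)"
      proof (rule sum.cong[OF refl])
        fix s assume "s \<in> S"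
        then have "s $ i = M $$ (i, idx s)"
          using idx[of s] M i index_col[of i M "idx s"] by simp
        then show "a s * s $ i = M $$ (i, idx s) * a s" by simp
      qed
      also have "\<dots> = (\<Sum>c<q. M $$ (i, c) * v $ c)"
        by (simp add: expand)
      also have "\<dots> = (M *\<^sub>v v) $ i"
        using M v i by (simp add: scalar_prod_def lessThan_atLeast0)
      finally show "lincomb a S $ i = 0\<^sub>v p $ i"
        using Mv by simp
    qed
    moreover obtain s where "s \<in> S" "a s \<noteq> 0"
      using a(1) by blast
    ultimately have "lin_dep S"
      using lin_dep_crit[OF finS subset_refl, where a = a] by auto
    then show False
      using S(2) by blast
  qed
  then show ?thesis
    using rank_card_indpt[OF M maxS] by simp
qed

section \<open>Positions of blocks and entries of submatrices\<close>

lemma pick_bij_betw: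
  assumes "finite J"
  shows "bij_betw (pick J) {..<card J} J"
proof -
  have "inj_on (pick J) {..<card J}"
    by (rule inj_onI) (metis lessThan_iff linorder_neqE_nat pick_mono_le less_irrefl)
  moreover have "pick J ` {..<card J} \<subseteq> J"
    by (auto intro: pick_in_set_le)
  ultimately show ?thesis
    using assms by (simp add: bij_betw_def card_image card_subset_eq)
qed

text \<open>The elements below the picked one are counted twice: there are \<open>a\<close> of them
  by \<open>card_pick_le\<close>, and they form an initial piece of the interval.\<close>

lemma pick_interval:
  assumes "a < k"
  shows "pick {m..<m + k} a = m + a"
proof -
  let ?S = "{m..<m + k}"
  have a: "a < card ?S" using assms by simp
  have p: "pick ?S a \<in> ?S" using pick_in_set_le[OF a] .
  then have "{x \<in> ?S. x < pick ?S a} = {m..<pick ?S a}" by auto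
  then have "pick ?S a - m = a"
    using card_pick_le[OF a] by simp
  then show ?thesis using p by auto
qed

definition offset :: "(nat \<Rightarrow> nat) \<Rightarrow> nat \<Rightarrow> nat" where
  "offset N i = (\<Sum>k\<in>{1..<i}. N k)"

text \<open>The hypothesis excludes index 0, where \<open>block_indices\<close> is empty whatever
  \<open>N 0\<close> is.\<close>

lemma block_indices_offset:
  assumes "1 \<le> i"
  shows "block_indices N i = {offset N i..<offset N i + N i}"
proof -
  have "{1..i} = insert i {1..<i}" using assms by auto
  then show ?thesis by (simp add: block_indices_def offset_def add.commute)
qed

lemma offset_mono:
  assumes "1 \<le> i" "i < j"
  shows "offset N i + N i \<le> offset N j"
proof -
  have "offset N i + N i = (\<Sum>k\<in>insert i {1..<i}. N k)"
    by (simp add: offset_def add.commute)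
  also have "\<dots> \<le> offset N j"
    unfolding offset_def using assms by (intro sum_mono2) auto
  finally show ?thesis .
qed

lemma offset_le_total:
  assumes "i \<in> {1..n}"
  shows "offset N i + N i \<le> (\<Sum>k\<in>{1..n}. N k)"
  \<comment> \<open>The total size is the offset of a fictitious further vertex
    \<open>Suc n\<close>.\<close>
  using offset_mono[of i "Suc n" N] assms
  by (simp add: offset_def atLeastLessThanSuc_atLeastAtMost)

lemma block_indices_disjoint:
  assumes "1 \<le> i" "1 \<le> j" "i \<noteq> j"
  shows "block_indices N i \<inter> block_indices N j = {}"
proof (cases "i < j")
  case True
  then show ?thesis using offset_mono[of i j N] assms by (auto simp: block_indices_offset)
next
  case False
  then show ?thesis using offset_mono[of j i N] assms by (auto simp: block_indices_offset)
qed

lemma block_indices_subset_total: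
  assumes "S \<subseteq> {1..n}"
  shows "(\<Union>i\<in>S. block_indices N i) \<subseteq> {..<(\<Sum>k\<in>{1..n}. N k)}"
proof
  fix q assume "q \<in> (\<Union>i\<in>S. block_indices N i)"
  then obtain i where "i \<in> S" "q \<in> block_indices N i" by blast
  then show "q \<in> {..<(\<Sum>k\<in>{1..n}. N k)}"
    using offset_le_total[of i n N] assms block_indices_offset[of i N] by auto
qed

text \<open>Links the flat indices of \<open>submatrix\<close> with the vertexwise coordinates of
  the DV equations: blocks of distinct vertices are disjoint, and each is a shifted initial
  interval.\<close>

lemma sum_block_indices:
  assumes "S \<subseteq> {1..n}"
  shows "(\<Sum>q\<in>(\<Union>j\<in>S. block_indices N j). f q) = (\<Sum>j\<in>S. \<Sum>c<N j. f (offset N j + c))"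
proof -
  have fin: "finite S" using assms finite_subset by blast
  have "(\<Sum>q\<in>(\<Union>j\<in>S. block_indices N j). f q) = (\<Sum>j\<in>S. \<Sum>q\<in>block_indices N j. f q)"
  proof (intro sum.UNION_disjoint fin ballI impI)
    fix i j assume "i \<in> S" "j \<in> S" "i \<noteq> j"
    then show "block_indices N i \<inter> block_indices N j = {}"
      using assms by (intro block_indices_disjoint) auto
  qed (simp add: block_indices_def)
  also have "\<dots> = (\<Sum>j\<in>S. \<Sum>c<N j. f (offset N j + c))"
  proof (rule sum.cong[OF refl])
    fix j assume "j \<in> S"
    then have "block_indices N j = {0 + offset N j..<N j + offset N j}"
      using block_indices_offset[of j N] assms by (auto simp: add.commute)
    then show "(\<Sum>q\<in>block_indices N j. f q) = (\<Sum>c<N j. f (offset N j + c))"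
      by (simp only: sum.shift_bounds_nat_ivl) (simp add: lessThan_atLeast0 add.commute)
  qed
  finally show ?thesis .
qed

lemma block_submatrix_carrier:
  assumes "A \<in> carrier_mat (\<Sum>k\<in>{1..n}. N k) (\<Sum>k\<in>{1..n}. N k)" "S \<subseteq> {1..n}" "T \<subseteq> {1..n}"
  shows "block_submatrix N A S T \<in>
    carrier_mat (card (\<Union>i\<in>S. block_indices N i)) (card (\<Union>j\<in>T. block_indices N j))"
proof -
  \<comment> \<open>\<open>submatrix\<close> counts only selected indices below the dimension of the
    matrix; here all selected indices are.\<close>
  have *: "{q. q < (\<Sum>k\<in>{1..n}. N k) \<and> q \<in> (\<Union>i\<in>R. block_indices N i)} = (\<Union>i\<in>R. block_indices N i)"
    if "R \<subseteq> {1..n}" for R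
    using block_indices_subset_total[OF that, of N] by auto
  show ?thesis
    unfolding block_submatrix_def using assms *[OF assms(2)] *[OF assms(3)]
    by (intro carrier_matI) (simp_all only: dim_submatrix carrier_matD)
qed

lemma block_submatrix_index:
  assumes "A \<in> carrier_mat (\<Sum>k\<in>{1..n}. N k) (\<Sum>k\<in>{1..n}. N k)" "S \<subseteq> {1..n}" "T \<subseteq> {1..n}"
    and "a < card (\<Union>i\<in>S. block_indices N i)" "c < card (\<Union>j\<in>T. block_indices N j)"
  shows "block_submatrix N A S T $$ (a, c) =
    A $$ (pick (\<Union>i\<in>S. block_indices N i) a, pick (\<Union>j\<in>T. block_indices N j) c)"
  using block_submatrix_carrier[OF assms(1-3)] assms(4,5)
  unfolding block_submatrix_def
  by (intro submatrix_index) (simp_all only: carrier_mat_def mem_Collect_eq dim_submatrix)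

lemma block_carrier:
  assumes "A \<in> carrier_mat (\<Sum>k\<in>{1..n}. N k) (\<Sum>k\<in>{1..n}. N k)" "i \<in> {1..n}" "j \<in> {1..n}"
  shows "block N A i j \<in> carrier_mat (N i) (N j)"
  using block_submatrix_carrier[OF assms(1), of "{i}" "{j}"] assms(2,3)
  by (simp add: block_def block_indices_offset)

lemma block_index:
  assumes "A \<in> carrier_mat (\<Sum>k\<in>{1..n}. N k) (\<Sum>k\<in>{1..n}. N k)" "i \<in> {1..n}" "j \<in> {1..n}"
    and "a < N i" "c < N j"
  shows "block N A i j $$ (a, c) = A $$ (offset N i + a, offset N j + c)"
  using block_submatrix_index[OF assms(1), of "{i}" "{j}" a c] assms(2-5)
  by (simp add: block_def block_indices_offset pick_interval)

section \<open>The DV equations and their solutions\<close>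

locale dv_data =
  fixes n :: nat and E :: "nat set set" and N r :: "nat \<Rightarrow> nat" and A :: "real mat"
    and V D :: "nat \<Rightarrow> real mat" and W U :: "nat \<Rightarrow> nat \<Rightarrow> real mat"
  assumes partitioned: "graph_partitioned_matrix n E N A"
    and representation: "dv_representation n E N A r V D W U"
begin

abbreviation solution where
  "solution \<equiv> dv_solution n E N r V D W U"

lemma carriers:
  assumes "i \<in> {1..n}"
  shows "V i \<in> carrier_mat (N i) (r i)" "D i \<in> carrier_mat (N i) (N i)"
    and "j \<in> neighbours E i \<Longrightarrow> W i j \<in> carrier_mat (r i) (r j)"
    and "j \<in> neighbours E i \<Longrightarrow> U i j \<in> carrier_mat (N i) (r j)"
  using representation assms by (auto simp: dv_representation_def)

lemma A_carrier: "A \<in> carrier_mat (\<Sum>k\<in>{1..n}. N k) (\<Sum>k\<in>{1..n}. N k)"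
  using partitioned by (simp add: graph_partitioned_matrix_def)

lemma edge_subset: "e \<in> E \<Longrightarrow> e \<subseteq> {1..n} \<and> card e = 2"
  using partitioned by (auto simp: graph_partitioned_matrix_def simple_graph_def)

lemma finite_edges: "finite E"
  using edge_subset by (meson finite_Pow_iff finite_atLeastAtMost finite_subset PowI subsetI)

lemma neighbours_subset: "neighbours E i \<subseteq> {1..n}"
  using edge_subset by (auto simp: neighbours_def)

lemma finite_neighbours: "finite (neighbours E i)"
  using neighbours_subset finite_subset by blast

text \<open>With vector sums and matrix products expanded into sums of reals, linearity and
  truncation of solutions become manipulations of real sums.\<close>

lemma solution_iff:
  assumes x: "x \<in> (\<Pi> i\<in>{1..n}. carrier_vec (N i))"
  shows "solution x g b \<longleftrightarrow>
    g \<in> (\<Pi>\<^sub>E i\<in>{1..n}. carrier_vec (r i)) \<and> b \<in> (\<Pi>\<^sub>E i\<in>{1..n}. carrier_vec (N i)) \<and>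
    (\<forall>i\<in>{1..n}.
       (\<forall>a<r i. g i $ a = (\<Sum>c<N i. V i $$ (c, a) * x i $ c) +
          (\<Sum>j\<in>neighbours E i. \<Sum>c<r j. W i j $$ (a, c) * g j $ c)) \<and>
       (\<forall>a<N i. b i $ a = (\<Sum>c<N i. D i $$ (a, c) * x i $ c) +
          (\<Sum>j\<in>neighbours E i. \<Sum>c<r j. U i j $$ (a, c) * g j $ c)))"
proof -
  have vec_eq: "u = w \<longleftrightarrow> (\<forall>a<m. u $ a = w $ a)"
    if "u \<in> carrier_vec m" "w \<in> carrier_vec m" for u w :: "real vec" and m
    using that by (metis carrier_vecD eq_vecI)
  have eqs: "(g i = transpose_mat (V i) *\<^sub>v x i +
                finsum_vec TYPE(real) (r i) (\<lambda>j. W i j *\<^sub>v g j) (neighbours E i) \<longleftrightarrow>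
              (\<forall>a<r i. g i $ a = (\<Sum>c<N i. V i $$ (c, a) * x i $ c) +
                (\<Sum>j\<in>neighbours E i. \<Sum>c<r j. W i j $$ (a, c) * g j $ c))) \<and>
             (b i = D i *\<^sub>v x i +
                finsum_vec TYPE(real) (N i) (\<lambda>j. U i j *\<^sub>v g j) (neighbours E i) \<longleftrightarrow>
              (\<forall>a<N i. b i $ a = (\<Sum>c<N i. D i $$ (a, c) * x i $ c) +
                (\<Sum>j\<in>neighbours E i. \<Sum>c<r j. U i j $$ (a, c) * g j $ c)))"
    if i: "i \<in> {1..n}" and g: "\<And>j. j \<in> {1..n} \<Longrightarrow> g j \<in> carrier_vec (r j)"
      and b: "b i \<in> carrier_vec (N i)" for i
  proof -
    have xi: "x i \<in> carrier_vec (N i)" using x i by auto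
    have gj: "j \<in> neighbours E i \<Longrightarrow> g j \<in> carrier_vec (r j)" for j
      using g neighbours_subset by blast
    have Wg: "(\<lambda>j. W i j *\<^sub>v g j) \<in> neighbours E i \<rightarrow> carrier_vec (r i)"
      using carriers(3)[OF i] by (auto intro!: mult_mat_vec_carrier gj)
    have Ug: "(\<lambda>j. U i j *\<^sub>v g j) \<in> neighbours E i \<rightarrow> carrier_vec (N i)"
      using carriers(4)[OF i] by (auto intro!: mult_mat_vec_carrier gj)
    have sW: "finsum_vec TYPE(real) (r i) (\<lambda>j. W i j *\<^sub>v g j) (neighbours E i) \<in> carrier_vec (r i)"
      using Wg by (rule finsum_vec_closed)
    have sU: "finsum_vec TYPE(real) (N i) (\<lambda>j. U i j *\<^sub>v g j) (neighbours E i) \<in> carrier_vec (N i)"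
      using Ug by (rule finsum_vec_closed)
    have mult: "(M *\<^sub>v w) $ a = (\<Sum>c<l. M $$ (a, c) * w $ c)"
      if "M \<in> carrier_mat m l" "w \<in> carrier_vec l" "a < m" for M :: "real mat" and w m l a
      using that by (auto simp: scalar_prod_def lessThan_atLeast0)
    have "transpose_mat (V i) *\<^sub>v x i \<in> carrier_vec (r i)"
      using carriers(1)[OF i] xi by auto
    moreover have "(transpose_mat (V i) *\<^sub>v x i +
        finsum_vec TYPE(real) (r i) (\<lambda>j. W i j *\<^sub>v g j) (neighbours E i)) $ a =
      (\<Sum>c<N i. V i $$ (c, a) * x i $ c) +
        (\<Sum>j\<in>neighbours E i. \<Sum>c<r j. W i j $$ (a, c) * g j $ c)" if a: "a < r i" for a
    proof -
      have "(transpose_mat (V i) *\<^sub>v x i) $ a = (\<Sum>c<N i. V i $$ (c, a) * x i $ c)"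
        using carriers(1)[OF i] xi a by (subst mult[of _ "r i" "N i"]) auto
      moreover have "finsum_vec TYPE(real) (r i) (\<lambda>j. W i j *\<^sub>v g j) (neighbours E i) $ a =
          (\<Sum>j\<in>neighbours E i. \<Sum>c<r j. W i j $$ (a, c) * g j $ c)"
        unfolding index_finsum_vec[OF finite_neighbours a Wg]
        using carriers(3)[OF i] gj a by (intro sum.cong refl mult)
      ultimately show ?thesis using sW a by simp
    qed
    moreover have "D i *\<^sub>v x i \<in> carrier_vec (N i)"
      using carriers(2)[OF i] xi by auto
    moreover have "(D i *\<^sub>v x i +
        finsum_vec TYPE(real) (N i) (\<lambda>j. U i j *\<^sub>v g j) (neighbours E i)) $ a =
      (\<Sum>c<N i. D i $$ (a, c) * x i $ c) +
        (\<Sum>j\<in>neighbours E i. \<Sum>c<r j. U i j $$ (a, c) * g j $ c)" if a: "a < N i" for a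
    proof -
      have "(D i *\<^sub>v x i) $ a = (\<Sum>c<N i. D i $$ (a, c) * x i $ c)"
        using carriers(2)[OF i] xi a by (rule mult)
      moreover have "finsum_vec TYPE(real) (N i) (\<lambda>j. U i j *\<^sub>v g j) (neighbours E i) $ a =
          (\<Sum>j\<in>neighbours E i. \<Sum>c<r j. U i j $$ (a, c) * g j $ c)"
        unfolding index_finsum_vec[OF finite_neighbours a Ug]
        using carriers(4)[OF i] gj a by (intro sum.cong refl mult)
      ultimately show ?thesis using sU a by simp
    qed
    ultimately show ?thesis
      using vec_eq[OF g[OF i] add_carrier_vec[OF _ sW]] vec_eq[OF b add_carrier_vec[OF _ sU]]
      by auto
  qed
  \<comment> \<open>Families of wrong dimensions falsify both sides, so the equations need comparing
    only for well-dimensioned \<open>g\<close> and \<open>b\<close>.\<close>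
  show ?thesis
  proof (cases "g \<in> (\<Pi>\<^sub>E i\<in>{1..n}. carrier_vec (r i)) \<and> b \<in> (\<Pi>\<^sub>E i\<in>{1..n}. carrier_vec (N i))")
    case True
    then have "g j \<in> carrier_vec (r j)" "b j \<in> carrier_vec (N j)" if "j \<in> {1..n}" for j
      using that by (auto dest: PiE_mem)
    note eqs' = eqs[OF _ this]
    show ?thesis
      unfolding dv_solution_def
      by (intro conj_cong refl ball_cong eqs'[THEN conjunct1] eqs'[THEN conjunct2]) assumption+
  next
    case False
    then show ?thesis by (auto simp: dv_solution_def)
  qed
qed

lemma solution_exists:
  assumes "x \<in> (\<Pi> i\<in>{1..n}. carrier_vec (N i))"
  shows "\<exists>g b. solution x g b"
  using representation assms unfolding dv_representation_def by blast

lemma solution_unique: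
  assumes "x \<in> (\<Pi> i\<in>{1..n}. carrier_vec (N i))" "solution x g b" "solution x g' b'"
  shows "g = g' \<and> b = b'"
proof -
  have "\<exists>!(g, b). solution x g b"
    using representation assms(1) unfolding dv_representation_def by blast
  then show ?thesis
    using assms(2,3) by (metis (mono_tags, lifting) case_prodI prod.inject)
qed

text \<open>The output is expressed through entries of \<open>A\<close> at flat indices, the form in
  which a product with a submatrix of \<open>A\<close> will appear.\<close>

lemma solution_output:
  assumes x: "x \<in> (\<Pi> i\<in>{1..n}. carrier_vec (N i))" and sol: "solution x g b"
    and i: "i \<in> {1..n}" and a: "a < N i"
  shows "b i $ a = (\<Sum>j\<in>{1..n}. \<Sum>c<N j. A $$ (offset N i + a, offset N j + c) * x j $ c)"
proof -
  have car: "(\<lambda>j. block N A i j *\<^sub>v x j) \<in> {1..n} \<rightarrow> carrier_vec (N i)"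
    using block_carrier[OF A_carrier i] x by (auto intro!: mult_mat_vec_carrier)
  have "b i = finsum_vec TYPE(real) (N i) (\<lambda>j. block N A i j *\<^sub>v x j) {1..n}"
    using representation x sol i unfolding dv_representation_def by blast
  then have "b i $ a = (\<Sum>j\<in>{1..n}. (block N A i j *\<^sub>v x j) $ a)"
    using index_finsum_vec[OF _ a car] by simp
  also have "\<dots> = (\<Sum>j\<in>{1..n}. \<Sum>c<N j. A $$ (offset N i + a, offset N j + c) * x j $ c)"
  proof (rule sum.cong[OF refl])
    fix j assume j: "j \<in> {1..n}"
    have B: "block N A i j \<in> carrier_mat (N i) (N j)"
      using block_carrier[OF A_carrier i j] .
    have "x j \<in> carrier_vec (N j)" using x j by auto
    then have "(block N A i j *\<^sub>v x j) $ a = (\<Sum>c<N j. block N A i j $$ (a, c) * x j $ c)"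
      using B a by (auto simp: scalar_prod_def lessThan_atLeast0)
    also have "\<dots> = (\<Sum>c<N j. A $$ (offset N i + a, offset N j + c) * x j $ c)"
      using block_index[OF A_carrier i j a] by simp
    finally show "(block N A i j *\<^sub>v x j) $ a =
      (\<Sum>c<N j. A $$ (offset N i + a, offset N j + c) * x j $ c)" .
  qed
  finally show ?thesis .
qed

text \<open>The equations are linear in the input, \<open>g\<close> and the output jointly. This is
  what makes the coordinates of \<open>g\<close> linear functionals of the input. The restriction to
  \<open>{1..n}\<close> makes the combined families extensional, as \<open>dv_solution\<close>
  demands.\<close>

lemma solution_linear_combination:
  assumes X: "\<And>q. q \<in> Q \<Longrightarrow> X q \<in> (\<Pi> i\<in>{1..n}. carrier_vec (N i))"
    and sol: "\<And>q. q \<in> Q \<Longrightarrow> solution (X q) (G q) (B q)"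
  shows "solution (\<lambda>i. vec (N i) (\<lambda>a. \<Sum>q\<in>Q. w q * X q i $ a))
    (\<lambda>i\<in>{1..n}. vec (r i) (\<lambda>a. \<Sum>q\<in>Q. w q * G q i $ a))
    (\<lambda>i\<in>{1..n}. vec (N i) (\<lambda>a. \<Sum>q\<in>Q. w q * B q i $ a))"
    (is "solution ?x ?g ?b")
proof -
  have swap: "(\<Sum>q\<in>Q. w q * ((\<Sum>c<l. F c * Y q c) + (\<Sum>j\<in>J. \<Sum>c<m j. H j c * Z q j c))) =
      (\<Sum>c<l. F c * (\<Sum>q\<in>Q. w q * Y q c)) + (\<Sum>j\<in>J. \<Sum>c<m j. H j c * (\<Sum>q\<in>Q. w q * Z q j c))"
    for l F Y m H Z and J :: "nat set"
  proof -
    have "(\<Sum>q\<in>Q. w q * (\<Sum>c<k. F' c * Y' q c)) = (\<Sum>c<k. F' c * (\<Sum>q\<in>Q. w q * Y' q c))"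
      for k F' Y'
      unfolding sum_distrib_left by (subst sum.swap) (simp add: mult.left_commute)
    note vec = this
    have "(\<Sum>q\<in>Q. w q * (\<Sum>j\<in>J. S q j)) = (\<Sum>j\<in>J. \<Sum>q\<in>Q. w q * S q j)" for S
      unfolding sum_distrib_left by (rule sum.swap)
    then show ?thesis
      by (simp add: distrib_left sum.distrib vec)
  qed
  have g: "G q i $ a = (\<Sum>c<N i. V i $$ (c, a) * X q i $ c) +
      (\<Sum>j\<in>neighbours E i. \<Sum>c<r j. W i j $$ (a, c) * G q j $ c)"
    if "q \<in> Q" "i \<in> {1..n}" "a < r i" for q i a
    using sol[OF that(1)] that unfolding solution_iff[OF X[OF that(1)]] by blast
  have b: "B q i $ a = (\<Sum>c<N i. D i $$ (a, c) * X q i $ c) +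
      (\<Sum>j\<in>neighbours E i. \<Sum>c<r j. U i j $$ (a, c) * G q j $ c)"
    if "q \<in> Q" "i \<in> {1..n}" "a < N i" for q i a
    using sol[OF that(1)] that unfolding solution_iff[OF X[OF that(1)]] by blast
  have gj: "?g j $ c = (\<Sum>q\<in>Q. w q * G q j $ c)" if "j \<in> neighbours E i" "c < r j" for i j c
    using that neighbours_subset[of i] by auto
  have gsum: "(\<Sum>j\<in>neighbours E i. \<Sum>c<r j. M j c * ?g j $ c) =
      (\<Sum>j\<in>neighbours E i. \<Sum>c<r j. M j c * (\<Sum>q\<in>Q. w q * G q j $ c))"
    for i and M :: "nat \<Rightarrow> nat \<Rightarrow> real"
    by (intro sum.cong refl) (simp only: gj[of _ i] lessThan_iff)
  have xsum: "(\<Sum>c<N i. M c * ?x i $ c) = (\<Sum>c<N i. M c * (\<Sum>q\<in>Q. w q * X q i $ c))"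
    for i and M :: "nat \<Rightarrow> real"
    by (intro sum.cong refl) simp
  have x: "?x \<in> (\<Pi> i\<in>{1..n}. carrier_vec (N i))" by simp
  show ?thesis
    unfolding solution_iff[OF x]
  proof (intro conjI ballI allI impI)
    fix i a assume i: "i \<in> {1..n}"
    \<comment> \<open>Read from right to left, \<open>swap\<close> gathers the right-hand side into
      a weighted sum of the right-hand sides of the individual equations. The equation for the
      output is treated alike.\<close>
    show "?g i $ a = (\<Sum>c<N i. V i $$ (c, a) * ?x i $ c) +
        (\<Sum>j\<in>neighbours E i. \<Sum>c<r j. W i j $$ (a, c) * ?g j $ c)" if "a < r i"
      unfolding gsum xsum by (subst swap[symmetric]) (use i that in \<open>simp add: g\<close>)
    show "?b i $ a = (\<Sum>c<N i. D i $$ (a, c) * ?x i $ c) +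
        (\<Sum>j\<in>neighbours E i. \<Sum>c<r j. U i j $$ (a, c) * ?g j $ c)" if "a < N i"
      unfolding gsum xsum by (subst swap[symmetric]) (use i that in \<open>simp add: b\<close>)
  qed auto
qed

text \<open>Truncating \<open>g\<close> and \<open>b\<close> to \<open>H\<close> preserves the
  neighbour sums at vertices of \<open>H\<close> and makes them zero at the others, so the equations
  survive and uniqueness applies.\<close>

lemma output_zero_outside:
  assumes x: "x \<in> (\<Pi> i\<in>{1..n}. carrier_vec (N i))" and sol: "solution x g b"
    and x0: "\<And>i. i \<in> {1..n} - H \<Longrightarrow> x i = 0\<^sub>v (N i)"
    and g0: "\<And>i j. i \<in> H \<Longrightarrow> j \<in> {1..n} - H \<Longrightarrow> {i, j} \<in> E \<Longrightarrow> g i = 0\<^sub>v (r i) \<and> g j = 0\<^sub>v (r j)"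
    and i: "i \<in> {1..n} - H"
  shows "b i = 0\<^sub>v (N i)"
proof -
  let ?g = "\<lambda>i\<in>{1..n}. if i \<in> H then g i else 0\<^sub>v (r i)"
  let ?b = "\<lambda>i\<in>{1..n}. if i \<in> H then b i else 0\<^sub>v (N i)"
  have car: "g \<in> (\<Pi>\<^sub>E i\<in>{1..n}. carrier_vec (r i))" "b \<in> (\<Pi>\<^sub>E i\<in>{1..n}. carrier_vec (N i))"
    using sol by (auto simp: solution_iff[OF x])
  \<comment> \<open>For a neighbour outside \<open>H\<close>, truncation changes nothing because
    \<open>g\<close> already vanishes at the outer endpoint of a crossing edge.\<close>
  have inside1: "?g j $ c = g j $ c" if "i \<in> H" "j \<in> neighbours E i" "c < r j" for i j c
  proof (cases "j \<in> H")
    case False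
    then show ?thesis
      using g0[of i j] that neighbours_subset[of i] by (auto simp: neighbours_def)
  qed (use that neighbours_subset[of i] in auto)
  \<comment> \<open>For a neighbour in \<open>H\<close>, it is the inner endpoint of the crossing
    edge at which \<open>g\<close> vanishes.\<close>
  have outside1: "?g j $ c = 0" if "i \<in> {1..n} - H" "j \<in> neighbours E i" "c < r j" for i j c
  proof (cases "j \<in> H")
    case True
    then show ?thesis
      using g0[of j i] that neighbours_subset[of i] by (auto simp: neighbours_def insert_commute)
  qed (use that neighbours_subset[of i] in auto)
  have inside: "(\<Sum>j\<in>neighbours E i. \<Sum>c<r j. M j c * ?g j $ c) =
      (\<Sum>j\<in>neighbours E i. \<Sum>c<r j. M j c * g j $ c)" if "i \<in> H" for i and M :: "nat \<Rightarrow> nat \<Rightarrow> real"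
    by (intro sum.cong refl) (simp only: inside1[OF that] lessThan_iff)
  have outside: "(\<Sum>j\<in>neighbours E i. \<Sum>c<r j. M j c * ?g j $ c) = 0"
    if "i \<in> {1..n} - H" for i and M :: "nat \<Rightarrow> nat \<Rightarrow> real"
    by (intro sum.neutral ballI) (simp only: outside1[OF that] lessThan_iff mult_zero_right)
  have "solution x ?g ?b"
    unfolding solution_iff[OF x]
  proof (intro conjI ballI allI impI)
    show "?g \<in> (\<Pi>\<^sub>E i\<in>{1..n}. carrier_vec (r i))" "?b \<in> (\<Pi>\<^sub>E i\<in>{1..n}. carrier_vec (N i))"
      using car by (auto dest: PiE_mem)
    fix i a assume i: "i \<in> {1..n}"
    show "?g i $ a = (\<Sum>c<N i. V i $$ (c, a) * x i $ c) +
        (\<Sum>j\<in>neighbours E i. \<Sum>c<r j. W i j $$ (a, c) * ?g j $ c)" if "a < r i"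
    proof (cases "i \<in> H")
      case True
      then show ?thesis
        using sol i that unfolding solution_iff[OF x] inside[OF True] by simp
    next
      case False
      then have iH: "i \<in> {1..n} - H" using i by simp
      show ?thesis using iH that unfolding outside[OF iH] by (simp add: x0)
    qed
    show "?b i $ a = (\<Sum>c<N i. D i $$ (a, c) * x i $ c) +
        (\<Sum>j\<in>neighbours E i. \<Sum>c<r j. U i j $$ (a, c) * ?g j $ c)" if "a < N i"
    proof (cases "i \<in> H")
      case True
      then show ?thesis
        using sol i that unfolding solution_iff[OF x] inside[OF True] by simp
    next
      case False
      then have iH: "i \<in> {1..n} - H" using i by simp
      show ?thesis using iH that unfolding outside[OF iH] by (simp add: x0)
    qed
  qed
  then have "b = ?b" using solution_unique[OF x sol] by blast
  then have "b i = ?b i" by (rule fun_cong)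
  then show ?thesis using i by simp
qed

section \<open>Counting conditions at the boundary of an induced subgraph\<close>

text \<open>The functionals are the coordinates of \<open>g i\<close> for \<open>i\<close> in
  \<open>BH\<close>, taken on inputs supported on \<open>H\<close>. Any finite \<open>BH\<close>
  containing both endpoints of every crossing edge will do; the number of such edges enters only
  afterwards.\<close>

lemma rank_block_submatrix_le:
  assumes H: "H \<subseteq> {1..n}"
    and BH: "finite BH"
    and cover: "\<And>i j. i \<in> H \<Longrightarrow> j \<in> {1..n} - H \<Longrightarrow> {i, j} \<in> E \<Longrightarrow> i \<in> BH \<and> j \<in> BH"
  shows "mat_rank (block_submatrix N A ({1..n} - H) H) \<le> (\<Sum>i\<in>BH. r i)"
proof -
  define I where "I = (\<Union>i\<in>{1..n} - H. block_indices N i)"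
  define J where "J = (\<Union>j\<in>H. block_indices N j)"
  let ?M = "block_submatrix N A ({1..n} - H) H"
  have M: "?M \<in> carrier_mat (card I) (card J)"
    unfolding I_def J_def by (rule block_submatrix_carrier[OF A_carrier _ H]) auto
  have finJ: "finite J"
    unfolding J_def using H finite_subset by (auto simp: block_indices_def)
  \<comment> \<open>\<open>X c\<close> is the unit input at the flat index of column
    \<open>c\<close> of the submatrix; the values \<open>G c\<close> solving for it are the
    coefficients of the functionals.\<close>
  define X :: "nat \<Rightarrow> nat \<Rightarrow> real vec"
    where "X c = (\<lambda>j. vec (N j) (\<lambda>a. if offset N j + a = pick J c then 1 else 0))" for c
  have X: "X c \<in> (\<Pi> i\<in>{1..n}. carrier_vec (N i))" for c
    by (simp add: X_def)
  obtain G B where GB: "\<And>c. solution (X c) (G c) (B c)"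
    using solution_exists[OF X] by metis
  have "vec_space.rank (card I) ?M \<le> card (SIGMA i:BH. {..<r i})"
  proof (rule rank_le_number_of_functionals[where f = "\<lambda>(i, a) c. G c i $ a", OF M])
    show "finite (SIGMA i:BH. {..<r i})" using BH by simp
    fix v assume v: "v \<in> carrier_vec (card J)"
      and "\<And>k. k \<in> (SIGMA i:BH. {..<r i}) \<Longrightarrow>
        (\<Sum>c<card J. (case k of (i, a) \<Rightarrow> \<lambda>c. G c i $ a) c * v $ c) = 0"
    then have Gv: "(\<Sum>c<card J. v $ c * G c i $ a) = 0" if "i \<in> BH" "a < r i" for i a
      using that by (force simp: mult.commute)
    define x where "x = (\<lambda>i. vec (N i) (\<lambda>a. \<Sum>c<card J. v $ c * X c i $ a))"
    define g where "g = (\<lambda>i\<in>{1..n}. vec (r i) (\<lambda>a. \<Sum>c<card J. v $ c * G c i $ a))"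
    define b where "b = (\<lambda>i\<in>{1..n}. vec (N i) (\<lambda>a. \<Sum>c<card J. v $ c * B c i $ a))"
    \<comment> \<open>\<open>y\<close> extends \<open>v\<close> by zero from the columns in
      \<open>J\<close> to all flat indices, so that \<open>x\<close> is \<open>y\<close> cut into
      blocks.\<close>
    define y where "y q = (\<Sum>c<card J. if q = pick J c then v $ c else 0)" for q
    have x_y: "x i $ a = y (offset N i + a)" if "a < N i" for i a
      using that by (simp add: x_def y_def X_def if_distrib cong: if_cong)
    have y_pick: "y (pick J c) = v $ c" if "c < card J" for c
    proof -
      have "y (pick J c) = (\<Sum>d<card J. if d = c then v $ d else 0)"
        unfolding y_def using pick_bij_betw[OF finJ] that
        by (intro sum.cong refl) (auto simp: bij_betw_def dest: inj_onD)
      then show ?thesis using that by simp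
    qed
    have y_0: "y q = 0" if "q \<notin> J" for q
      unfolding y_def using that pick_in_set_le[of _ J] by (auto intro!: sum.neutral)
    have xc: "x \<in> (\<Pi> i\<in>{1..n}. carrier_vec (N i))"
      by (simp add: x_def)
    have sol: "solution x g b"
      unfolding x_def g_def b_def by (rule solution_linear_combination[OF X GB])
    have x0: "x i = 0\<^sub>v (N i)" if i: "i \<in> {1..n} - H" for i
    proof (rule eq_vecI)
      fix a assume "a < dim_vec (0\<^sub>v (N i))"
      then have a: "a < N i" by simp
      have "offset N i + a \<notin> J"
      proof
        assume "offset N i + a \<in> J"
        then obtain j where "j \<in> H" "offset N i + a \<in> block_indices N j"
          by (auto simp: J_def)
        moreover have "offset N i + a \<in> block_indices N i"
          using i a by (simp add: block_indices_offset)
        moreover have "1 \<le> i" "1 \<le> j" "i \<noteq> j"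
          using i \<open>j \<in> H\<close> H by auto
        ultimately show False
          using block_indices_disjoint[of i j N] by blast
      qed
      then show "x i $ a = 0\<^sub>v (N i) $ a" using a by (simp add: x_y y_0)
    qed (simp add: x_def)
    have g0: "g i = 0\<^sub>v (r i)" if "i \<in> BH" "i \<in> {1..n}" for i
      using that Gv by (intro eq_vecI) (auto simp: g_def)
    have b0: "b i = 0\<^sub>v (N i)" if "i \<in> {1..n} - H" for i
    proof (rule output_zero_outside[OF xc sol x0 _ that])
      show "g i = 0\<^sub>v (r i) \<and> g j = 0\<^sub>v (r j)"
        if "i \<in> H" "j \<in> {1..n} - H" "{i, j} \<in> E" for i j
        using cover[OF that] g0 that H by blast
    qed
    show "?M *\<^sub>v v = 0\<^sub>v (card I)"
    proof (rule eq_vecI)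
      fix a assume "a < dim_vec (0\<^sub>v (card I))"
      then have a: "a < card I" by simp
      then have "pick I a \<in> I" by (rule pick_in_set_le)
      then obtain i where i: "i \<in> {1..n} - H" "pick I a \<in> block_indices N i"
        by (auto simp: I_def)
      then obtain a' where a': "a' < N i" "pick I a = offset N i + a'"
        using block_indices_offset[of i N]
        by (auto simp: le_iff_add)
      \<comment> \<open>The product is summed over flat indices in \<open>J\<close>, then over the
        blocks of \<open>H\<close>, then over all blocks, as \<open>x\<close> vanishes off
        \<open>H\<close>. The result is an output coordinate at a vertex outside
        \<open>H\<close>.\<close>
      have "(?M *\<^sub>v v) $ a = (\<Sum>c<card J. ?M $$ (a, c) * v $ c)"
        using M v a by (auto simp: scalar_prod_def lessThan_atLeast0)
      also have "\<dots> = (\<Sum>c<card J. A $$ (pick I a, pick J c) * y (pick J c))"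
        using a block_submatrix_index[OF A_carrier Diff_subset H, of a H, folded I_def J_def]
        by (intro sum.cong refl) (simp add: y_pick)
      also have "\<dots> = (\<Sum>q\<in>J. A $$ (pick I a, q) * y q)"
        using pick_bij_betw[OF finJ] by (rule sum.reindex_bij_betw)
      also have "\<dots> = (\<Sum>j\<in>H. \<Sum>c<N j. A $$ (pick I a, offset N j + c) * y (offset N j + c))"
        unfolding J_def by (rule sum_block_indices[OF H])
      also have "\<dots> = (\<Sum>j\<in>H. \<Sum>c<N j. A $$ (pick I a, offset N j + c) * x j $ c)"
        by (simp add: x_y)
      also have "\<dots> = (\<Sum>j\<in>{1..n}. \<Sum>c<N j. A $$ (pick I a, offset N j + c) * x j $ c)"
        using H by (intro sum.mono_neutral_left) (auto simp: x0)
      also have "\<dots> = b i $ a'"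
        using solution_output[OF xc sol _ a'(1)] i(1) a'(2) by simp
      also have "\<dots> = 0"
        using b0[OF i(1)] a'(1) by simp
      finally show "(?M *\<^sub>v v) $ a = 0\<^sub>v (card I) $ a" using a by simp
    qed (use M in auto)
  qed
  also have "\<dots> = (\<Sum>i\<in>BH. r i)"
    using BH by simp
  finally show ?thesis
    using M by (simp add: mat_rank_def)
qed

text \<open>The endpoints of the crossing edges form \<open>\<Union>C\<close>, which has at most two
  elements per edge; each contributes at most the maximal dimension.\<close>

lemma girs: "girs n E N A (2 * real (Max (r ` {1..n})))"
  unfolding girs_def
proof (intro allI impI)
  fix H assume H: "H \<subseteq> {1..n}"
  define C where "C = {e \<in> E. \<exists>i\<in>H. \<exists>j\<in>{1..n} - H. e = {i, j}}"
  have C: "finite C" "C \<subseteq> E"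
    using finite_edges by (auto simp: C_def)
  have endpoints: "\<Union>C \<subseteq> {1..n}"
    using C(2) edge_subset by blast
  then have fin: "finite (\<Union>C)"
    using finite_subset by blast
  have "card (\<Union>C) \<le> (\<Sum>e\<in>C. card e)"
    by (rule card_Union_le_sum_card)
  also have "\<dots> = (\<Sum>e\<in>C. 2)"
    using C(2) edge_subset by (intro sum.cong) auto
  finally have card: "card (\<Union>C) \<le> 2 * card C" by simp
  have "mat_rank (block_submatrix N A ({1..n} - H) H) \<le> (\<Sum>i\<in>\<Union>C. r i)"
  proof (rule rank_block_submatrix_le[OF H fin])
    fix i j assume "i \<in> H" "j \<in> {1..n} - H" "{i, j} \<in> E"
    then have "{i, j} \<in> C" unfolding C_def by blast
    then show "i \<in> \<Union>C \<and> j \<in> \<Union>C" by blast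
  qed
  \<comment> \<open>For \<open>n = 0\<close> the \<open>Max\<close> is taken over the empty set, but
    then \<open>\<Union>C\<close> is empty and both sums are zero.\<close>
  also have "\<dots> \<le> (\<Sum>i\<in>\<Union>C. Max (r ` {1..n}))"
    using endpoints by (intro sum_mono) (auto intro!: Max_ge)
  also have "\<dots> \<le> 2 * card C * Max (r ` {1..n})"
    using card by simp
  finally have "real (mat_rank (block_submatrix N A ({1..n} - H) H)) \<le>
      real (2 * card C * Max (r ` {1..n}))"
    by (rule of_nat_mono)
  then show "real (mat_rank (block_submatrix N A ({1..n} - H) H)) \<le>
      2 * real (Max (r ` {1..n})) * real (cut_size n E H)"
    by (simp add: cut_size_def C_def mult_ac)
qed

end

theorem proposition2p7:
  fixes n :: nat and E :: "nat set set" and N r :: "nat \<Rightarrow> nat" and A :: "real mat"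
  assumes "graph_partitioned_matrix n E N A"
    and "\<exists>V D W U. dv_representation n E N A r V D W U"
  shows "girs n E N A (2 * real (Max (r ` {1..n})))"
proof -
  obtain V D W U where "dv_representation n E N A r V D W U"
    using assms(2) by blast
  then interpret dv_data n E N r A V D W U
    using assms(1) by unfold_locales
  show ?thesis by (rule girs)
qed

end
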